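(* Let $Q$ be a quiver with no oriented cycles and let $\theta\in\mathbb{Z}^{Q_0}$ be a weight. Let $F=\mathbb{C}[t_m\mid m\in\nabla(Q,\theta)\cap\mathbb{Z}^{Q_1}]$ be the polynomial ring with one variable for each lattice point of $\nabla(Q,\theta)$, with the standard grading, and let $\varphi:F\to\mathcal{A}(Q,\theta)$ be the $\mathbb{C}$-algebra surjection $t_m\mapsto x^m$. Then the ideal $\ker(\varphi)$ is generated by elements of degree at most $3$.
   Context: A quiver $Q$ is a finite directed graph with vertex set $Q_0$ and arrow set $Q_1$ (multiple arrows allowed); an arrow $a$ goes from $a^-$ to $a^+$. For a weight $\theta\in\mathbb{Z}^{Q_0}$ the quiver polyhedron is $\nabla(Q,\theta)=\{x\in\mathbb{R}^{Q_1}\mid x\ge 0,\ \forall v\in Q_0:\ \theta(v)=\sum_{a^+=v}x(a)-\sum_{a^-=v}x(a)\}$ (a polytope when $Q$ has no oriented cycles). In the polynomial ring $\mathbb{C}[x(a)\mid a\in Q_1]$ write $x^m=\prod_{a\in Q_1}x(a)^{m(a)}$ for $m\in\mathbb{Z}_{\ge 0}^{Q_1}$, and let $\mathcal{A}(Q,\theta)$ be the subalgebra generated by the $x^m$ with $m\in\nabla(Q,\theta)\cap\mathbb{Z}^{Q_1}$ (the homogeneous coordinate ring of the toric quiver variety in its natural embedding into projective space). *)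

theory Defs
  imports Complex_Main "HOL-Library.Poly_Mapping"
begin

text \<open>Multivariate polynomials over the complex numbers in variables of type 'x:
  finitely supported maps from monomials (finitely supported exponent vectors) to coefficients.
  The convolution product of HOL-Library.Poly_Mapping makes this the polynomial ring.\<close>
type_synonym 'x cpoly = "('x \<Rightarrow>\<^sub>0 nat) \<Rightarrow>\<^sub>0 complex"

text \<open>Quiver: arrows of finite type 'a, vertices of finite type 'v, tail (a^-) and head (a^+).
  No oriented cycles: the relation v -> w (there is an arrow from v to w) is acyclic.\<close>
definition no_oriented_cycles :: "('a \<Rightarrow> 'v) \<Rightarrow> ('a \<Rightarrow> 'v) \<Rightarrow> bool" where
  "no_oriented_cycles tailQ headQ \<longleftrightarrow> acyclic {(tailQ a, headQ a) | a. True}"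

definition quiver_lattice_points ::
  "('a::finite \<Rightarrow> 'v) \<Rightarrow> ('a \<Rightarrow> 'v) \<Rightarrow> ('v \<Rightarrow> int) \<Rightarrow> ('a \<Rightarrow> nat) set" where
  "quiver_lattice_points tailQ headQ \<theta> =
     {m. \<forall>v. \<theta> v = (\<Sum>a\<in>{a. headQ a = v}. int (m a)) - (\<Sum>a\<in>{a. tailQ a = v}. int (m a))}"

definition cpoly_vars :: "'x cpoly \<Rightarrow> 'x set" where
  "cpoly_vars p = \<Union> ((\<lambda>mu::'x \<Rightarrow>\<^sub>0 nat. Poly_Mapping.keys mu) ` Poly_Mapping.keys p)"

text \<open>Total degree of a polynomial (0 for the zero polynomial).\<close>
definition cpoly_degree :: "'x cpoly \<Rightarrow> nat" where
  "cpoly_degree p = Max (insert 0 ((\<lambda>mu. \<Sum>x\<in>Poly_Mapping.keys mu. Poly_Mapping.lookup mu x) ` Poly_Mapping.keys p))"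

definition xmon :: "('a::finite \<Rightarrow> nat) \<Rightarrow> 'a cpoly" where
  "xmon m = Poly_Mapping.single (Abs_poly_mapping m) 1"

definition quiver_phi :: "('a::finite \<Rightarrow> nat) cpoly \<Rightarrow> 'a cpoly" where
  "quiver_phi p = (\<Sum>mu\<in>Poly_Mapping.keys p. Poly_Mapping.single 0 (Poly_Mapping.lookup p mu) *
                        (\<Prod>m\<in>Poly_Mapping.keys mu. xmon m ^ Poly_Mapping.lookup mu m))"

definition cpoly_ring :: "'x set \<Rightarrow> 'x cpoly set" where
  "cpoly_ring X = {p. cpoly_vars p \<subseteq> X}"

definition ideal_gen_in :: "'x cpoly set \<Rightarrow> 'x cpoly set \<Rightarrow> 'x cpoly set" where
  "ideal_gen_in R G = {\<Sum>i\<in>I. r i * g i | I r g. finite (I::nat set) \<and>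
                          (\<forall>i\<in>I. r i \<in> R \<and> g i \<in> G)}"

end

theory Submission
  imports Defs "HOL-Library.Multiset"
begin

text \<open>Kernel elements are combinations of binomials \<open>t\<^sup>M - t\<^sup>N\<close> for multisets \<open>M\<close>, \<open>N\<close> of lattice
  points (flows) with the same sum, so it suffices to connect \<open>M\<close> to \<open>N\<close> by moves that replace at
  most three flows at a time. By induction on the size it is enough to turn one member \<open>f\<close> of \<open>M\<close>
  into a given flow \<open>g\<close> of \<open>N\<close>. This is done one arrow at a time, exchanging units between \<open>f\<close> and
  a partner \<open>h\<close>. In between, \<open>f\<close> and \<open>h\<close> violate the flow condition at two vertices by
  opposite units, but \<open>f + h\<close> is always a sum of two genuine flows; replacing an exhausted
  partner \<open>h\<close> by another member \<open>x\<close> therefore involves only three flows.\<close>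

section \<open>Connecting multisets of flows\<close>

locale quiver =
  fixes tailQ headQ :: "'a::finite \<Rightarrow> 'v::finite"
begin

text \<open>Net inflow, taken for integer values so that it also applies to differences of flows and
  to signed paths.\<close>

definition excess :: "('a \<Rightarrow> int) \<Rightarrow> 'v \<Rightarrow> int" where
  "excess x v = (\<Sum>a | headQ a = v. x a) - (\<Sum>a | tailQ a = v. x a)"

lemma excess_add: "excess (\<lambda>a. x a + y a) v = excess x v + excess y v"
  by (simp add: excess_def sum.distrib)

lemma excess_diff: "excess (\<lambda>a. x a - y a) v = excess x v - excess y v"
  by (simp add: excess_def sum_subtractf)

lemma excess_zero: "excess (\<lambda>a. 0) v = 0"
  by (simp add: excess_def)

lemma excess_unit:
  "excess (\<lambda>b. of_bool (b = a)) v = of_bool (headQ a = v) - of_bool (tailQ a = v)"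
  by (simp add: excess_def of_bool_def)

text \<open>If no arrow offered such a step, the inflow sum would be nonnegative and the outflow sum
  nonpositive. The alternatives are the forward and backward steps by which a walk can leave
  \<open>s\<close>.\<close>

lemma excess_neg_step:
  assumes "excess d s < 0"
  obtains a where "tailQ a = s" "d a > 0" | a where "headQ a = s" "d a < 0"
proof -
  have "\<exists>a. tailQ a = s \<and> d a > 0 \<or> headQ a = s \<and> d a < 0"
  proof (rule ccontr)
    assume none: "\<not> ?thesis"
    have "(\<Sum>a | headQ a = s. d a) \<ge> 0"
      by (rule sum_nonneg) (use none in \<open>auto simp: not_less\<close>)
    moreover have "(\<Sum>a | tailQ a = s. d a) \<le> 0"
      by (rule sum_nonpos) (use none in \<open>auto simp: not_less\<close>)
    ultimately show False using assms by (simp add: excess_def)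
  qed
  then show thesis using that by blast
qed

text \<open>For \<open>d = x - y\<close> this is what allows \<open>P\<close> to pass from
  \<open>x\<close> to \<open>y\<close>: both results stay between the pointwise minimum and maximum
  of \<open>x\<close> and \<open>y\<close>.\<close>

definition conformal :: "('a \<Rightarrow> int) \<Rightarrow> ('a \<Rightarrow> int) \<Rightarrow> bool" where
  "conformal P d \<longleftrightarrow> (\<forall>a. min 0 (d a) \<le> P a \<and> P a \<le> max 0 (d a))"

definition l1 :: "('a \<Rightarrow> int) \<Rightarrow> nat" where
  "l1 d = (\<Sum>a\<in>UNIV. nat \<bar>d a\<bar>)"

lemma l1_less:
  assumes "nat \<bar>d' a\<bar> < nat \<bar>d a\<bar>" "\<And>b. b \<noteq> a \<Longrightarrow> d' b = d b"
  shows "l1 d' < l1 d"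
  unfolding l1_def
proof (rule sum_strict_mono_ex1)
  show "\<forall>b\<in>UNIV. nat \<bar>d' b\<bar> \<le> nat \<bar>d b\<bar>"
  proof
    fix b
    show "nat \<bar>d' b\<bar> \<le> nat \<bar>d b\<bar>" using assms by (cases "b = a") auto
  qed
qed (use assms(1) in auto)

text \<open>A walk from \<open>s\<close> that follows \<open>d\<close> and stops as soon as it meets \<open>v\<close>; it need not be
  a simple path, but since it never departs from \<open>v\<close> it uses no arrow with tail \<open>v\<close> positively.\<close>

lemma conformal_path:
  assumes "\<And>u. u \<noteq> v \<Longrightarrow> excess d u \<le> - of_bool (u = s)"
  shows "\<exists>P. conformal P d \<and> (\<forall>u. excess P u = of_bool (u = v) - of_bool (u = s))
           \<and> (\<forall>a. tailQ a = v \<longrightarrow> P a \<le> 0)"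
  using assms
proof (induction "l1 d" arbitrary: d s rule: less_induct)
  case less
  show ?case
  proof (cases "s = v")
    case True
    then show ?thesis
      by (intro exI[of _ "\<lambda>a. 0"]) (auto simp: conformal_def excess_zero)
  next
    case False
    with less.prems[of s] have "excess d s < 0" by simp
    then show ?thesis
    proof (cases rule: excess_neg_step)
      case (1 a)
      \<comment> \<open>Removing the traversed unit from \<open>d\<close> keeps the hypothesis, with
        the walk now at \<open>headQ a\<close>, and shrinks \<open>l1\<close>.\<close>
      define d1 where "d1 = (\<lambda>b. d b - of_bool (b = a))"
      have "l1 d1 < l1 d" by (rule l1_less[of _ a]) (use 1 in \<open>auto simp: d1_def\<close>)
      moreover have "excess d1 u \<le> - of_bool (u = headQ a)" if "u \<noteq> v" for u
        using less.prems[OF that] 1 by (auto simp: d1_def excess_diff excess_unit)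
      ultimately obtain P where P: "conformal P d1" "\<And>a. tailQ a = v \<Longrightarrow> P a \<le> 0"
        "\<And>u. excess P u = of_bool (u = v) - of_bool (u = headQ a)"
        using less.hyps[of d1 "headQ a"] by auto
      have "conformal (\<lambda>b. P b + of_bool (b = a)) d"
        unfolding conformal_def
      proof
        fix b
        show "min 0 (d b) \<le> P b + of_bool (b = a) \<and> P b + of_bool (b = a) \<le> max 0 (d b)"
          using P(1)[unfolded conformal_def, rule_format, of b] 1 by (cases "b = a") (auto simp: d1_def)
      qed
      then show ?thesis using P 1 False
        by (intro exI[of _ "\<lambda>b. P b + of_bool (b = a)"]) (auto simp: excess_add excess_unit)
    next
      case (2 a)
      define d1 where "d1 = (\<lambda>b. d b + of_bool (b = a))"
      have "l1 d1 < l1 d" by (rule l1_less[of _ a]) (use 2 in \<open>auto simp: d1_def\<close>)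
      moreover have "excess d1 u \<le> - of_bool (u = tailQ a)" if "u \<noteq> v" for u
        using less.prems[OF that] 2 by (auto simp: d1_def excess_add excess_unit)
      ultimately obtain P where P: "conformal P d1" "\<And>a. tailQ a = v \<Longrightarrow> P a \<le> 0"
        "\<And>u. excess P u = of_bool (u = v) - of_bool (u = tailQ a)"
        using less.hyps[of d1 "tailQ a"] by auto
      have "conformal (\<lambda>b. P b - of_bool (b = a)) d"
        unfolding conformal_def
      proof
        fix b
        show "min 0 (d b) \<le> P b - of_bool (b = a) \<and> P b - of_bool (b = a) \<le> max 0 (d b)"
          using P(1)[unfolded conformal_def, rule_format, of b] 2 by (cases "b = a") (auto simp: d1_def)
      qed
      \<comment> \<open>A backward step may use an arrow with tail \<open>v\<close>, but it only
        lowers the value there.\<close>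
      moreover have "P b - of_bool (b = a) \<le> 0" if "tailQ b = v" for b
        using P(2)[OF that] by (cases "b = a") auto
      ultimately show ?thesis using P(3) 2
        by (intro exI[of _ "\<lambda>b. P b - of_bool (b = a)"]) (auto simp: excess_diff excess_unit)
    qed
  qed
qed

section \<open>Flows and moves between multisets of flows\<close>

definition flows :: "('v \<Rightarrow> int) \<Rightarrow> ('a \<Rightarrow> int) set" where
  "flows \<theta> = {x. (\<forall>a. 0 \<le> x a) \<and> (\<forall>v. excess x v = \<theta> v)}"

lemma conformal_exchange_nonneg:
  assumes "conformal P (\<lambda>a. x a - y a)" "0 \<le> x a" "0 \<le> y a"
  shows "0 \<le> x a - P a" "0 \<le> y a + P a"
  using assms(1)[unfolded conformal_def, rule_format, of a] assms(2,3) by auto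

text \<open>The excess of \<open>f - h\<close> is twice the defect; one conformal path from
  \<open>s\<close> to \<open>v\<close> shifts half of it from \<open>f\<close> to \<open>h\<close>,
  which cancels both defects.\<close>

lemma balance_pair:
  assumes "\<And>a. 0 \<le> f a" "\<And>a. 0 \<le> h a"
    and "\<And>u. excess f u = \<theta> u + of_bool (u = v) - of_bool (u = s)"
    and "\<And>u. excess h u = \<theta> u - of_bool (u = v) + of_bool (u = s)"
  obtains p q where "p \<in> flows \<theta>" "q \<in> flows \<theta>" "\<And>a. p a + q a = f a + h a"
proof -
  obtain P where P: "conformal P (\<lambda>a. f a - h a)"
    "\<And>u. excess P u = of_bool (u = v) - of_bool (u = s)"
    using conformal_path[of v "\<lambda>a. f a - h a" s] assms(3,4) by (auto simp: excess_diff)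
  show thesis
  proof
    show "(\<lambda>a. f a - P a) \<in> flows \<theta>" "(\<lambda>a. h a + P a) \<in> flows \<theta>"
      using conformal_exchange_nonneg[OF P(1)] assms P(2)
      by (auto simp: flows_def excess_add excess_diff)
  qed simp
qed

text \<open>\<open>C\<close> is the untouched part. Equal sizes make every move homogeneous, and the
  empty move gives reflexivity.\<close>

inductive conn :: "('v \<Rightarrow> int) \<Rightarrow> ('a \<Rightarrow> int) multiset \<Rightarrow> ('a \<Rightarrow> int) multiset \<Rightarrow> bool"
  for \<theta> where
  move: "\<lbrakk>set_mset (A + B + C) \<subseteq> flows \<theta>; size A = size B; size B \<le> 3;
     \<And>a. (\<Sum>x\<in>#A. x a) = (\<Sum>x\<in>#B. x a)\<rbrakk> \<Longrightarrow> conn \<theta> (A + C) (B + C)"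
| trans: "\<lbrakk>conn \<theta> A B; conn \<theta> B C\<rbrakk> \<Longrightarrow> conn \<theta> A C"

lemma conn_invariant:
  assumes "conn \<theta> A B"
  shows "size A = size B \<and> (\<forall>a. (\<Sum>x\<in>#A. x a) = (\<Sum>x\<in>#B. x a))
    \<and> set_mset A \<subseteq> flows \<theta> \<and> set_mset B \<subseteq> flows \<theta>"
  using assms by induction auto

lemma conn_add:
  assumes "conn \<theta> A B" "g \<in> flows \<theta>"
  shows "conn \<theta> (add_mset g A) (add_mset g B)"
  using assms
proof induction
  case (move A B C)
  then show ?case using conn.move[of A B "add_mset g C" \<theta>] by simp
next
  case (trans A B C)
  then show ?case by (blast intro: conn.trans[of \<theta> "add_mset g A" "add_mset g B"])
qed

lemma conn_refl: "set_mset A \<subseteq> flows \<theta> \<Longrightarrow> conn \<theta> A A"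
  using conn.move[of "{#}" "{#}" A \<theta>] by simp

text \<open>The genuine flows \<open>p, q\<close> stand in for the defective pair \<open>f, h\<close>. When the next arrow \<open>a\<close>
  out of \<open>v\<close> cannot be borrowed from \<open>h\<close>, the defect of \<open>h\<close> is passed on to some \<open>x\<close> with
  \<open>x a > 0\<close> by a conformal path from \<open>s\<close> to \<open>v\<close>; as the path never departs from \<open>v\<close>, it
  does not consume \<open>a\<close>.\<close>

lemma conn_extract_defect:
  assumes g: "g \<in> flows \<theta>"
    and "\<And>a. 0 \<le> f a" "\<And>a. 0 \<le> h a"
    and "\<And>u. excess f u = \<theta> u + of_bool (u = v) - of_bool (u = s)"
    and "\<And>u. excess h u = \<theta> u - of_bool (u = v) + of_bool (u = s)"
    and "set_mset C \<subseteq> flows \<theta>" "p \<in> flows \<theta>" "q \<in> flows \<theta>"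
    and "\<And>a. p a + q a = f a + h a"
    and "\<And>a. g a \<le> f a + h a + (\<Sum>x\<in>#C. x a)"
  shows "\<exists>D. conn \<theta> (add_mset p (add_mset q C)) (add_mset g D)"
  using assms(2-)
\<comment> \<open>The \<open>l1\<close> distance from \<open>f\<close> to \<open>g\<close> drops
  with each arrow treated; the partner, the defect and the stand-ins all vary.\<close>
proof (induction "l1 (\<lambda>a. g a - f a)" arbitrary: f h v s C p q rule: less_induct)
  case less
  note f0 = less.prems(1) and h0 = less.prems(2) and ef = less.prems(3) and eh = less.prems(4)
    and C = less.prems(5) and p = less.prems(6) and q = less.prems(7) and pq = less.prems(8)
    and bound = less.prems(9)
  have g0: "\<And>a. 0 \<le> g a" and eg: "\<And>u. excess g u = \<theta> u"
    using g by (auto simp: flows_def)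
  show ?case
  proof (cases "g = f")
    case True
    \<comment> \<open>As \<open>g\<close> is a flow, so is \<open>f\<close>; the defect is void,
      \<open>h\<close> is a flow too, and \<open>p, q\<close> can be traded for
      \<open>g, h\<close>.\<close>
    have "of_bool (u = v) - of_bool (u = s) = (0::int)" for u
      using ef[of u] eg[of u] True by simp
    then have "h \<in> flows \<theta>"
      using eh h0 by (auto simp: flows_def algebra_simps)
    then have "conn \<theta> ({#p, q#} + C) ({#g, h#} + C)"
      using p q g C pq True by (intro conn.move) auto
    then show ?thesis by auto
  next
    case False
    \<comment> \<open>With \<open>v = s\<close> there is no defect, so both vertices may be moved to
      an end of any arrow where \<open>f\<close> and \<open>g\<close> differ. Otherwise
      \<open>g - f\<close> has negative excess at \<open>v\<close>, which yields an arrow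
      there.\<close>
    have "\<exists>v' s' a. (\<forall>u. of_bool (u = v') - of_bool (u = s') = (of_bool (u = v) - of_bool (u = s) :: int))
       \<and> (tailQ a = v' \<and> g a > f a \<or> headQ a = v' \<and> g a < f a)"
    proof (cases "v = s")
      case True
      obtain a where "g a \<noteq> f a" using False by auto
      then have "g a > f a \<or> g a < f a" by auto
      then show ?thesis using True by auto
    next
      case False
      then have "excess (\<lambda>a. g a - f a) v < 0"
        using ef[of v] eg[of v] by (simp add: excess_diff)
      then have "\<exists>a. tailQ a = v \<and> g a > f a \<or> headQ a = v \<and> g a < f a"
        by (rule excess_neg_step) (metis diff_gt_0_iff_gt diff_less_0_iff_less)+
      then obtain a where "tailQ a = v \<and> g a > f a \<or> headQ a = v \<and> g a < f a" ..
      then show ?thesis by (intro exI[of _ v] exI[of _ s] exI[of _ a]) simp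
    qed
    then obtain v' s' a
      where vs: "\<And>u. of_bool (u = v') - of_bool (u = s') = (of_bool (u = v) - of_bool (u = s) :: int)"
        and a: "tailQ a = v' \<and> g a > f a \<or> headQ a = v' \<and> g a < f a"
      by blast
    have ef: "excess f u = \<theta> u + of_bool (u = v') - of_bool (u = s')"
      and eh: "excess h u = \<theta> u - of_bool (u = v') + of_bool (u = s')" for u
      using ef[of u] eh[of u] vs[of u] by auto
    from a show ?thesis
    proof (elim disjE conjE)
      assume a: "headQ a = v'" "g a < f a"
      show ?thesis
      proof (rule less.hyps[of "\<lambda>b. f b - of_bool (b = a)" "\<lambda>b. h b + of_bool (b = a)" "tailQ a" s'])
        show "l1 (\<lambda>b. g b - (f b - of_bool (b = a))) < l1 (\<lambda>b. g b - f b)"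
          by (rule l1_less[of _ a]) (use a in auto)
        show "0 \<le> f b - of_bool (b = a)" for b
          using f0[of b] g0[of a] a by (cases "b = a") auto
      qed (use a h0 ef eh C p q pq bound in \<open>auto simp: excess_add excess_diff excess_unit\<close>)
    next
      assume a: "tailQ a = v'" "f a < g a"
      \<comment> \<open>Stated for arbitrary partners, as it serves both the given \<open>h\<close>
        and its replacement \<open>h'\<close>: one unit on \<open>a\<close> passes from the partner
        to \<open>f\<close>.\<close>
      have advance: "\<exists>D. conn \<theta> (add_mset p (add_mset q C)) (add_mset g D)"
        if "h a > 0" "\<And>b. 0 \<le> h b"
          "\<And>u. excess h u = \<theta> u - of_bool (u = v') + of_bool (u = s')"
          "set_mset C \<subseteq> flows \<theta>" "p \<in> flows \<theta>" "q \<in> flows \<theta>"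
          "\<And>a. p a + q a = f a + h a" "\<And>a. g a \<le> f a + h a + (\<Sum>x\<in>#C. x a)" for h C p q
      proof (rule less.hyps[of "\<lambda>b. f b + of_bool (b = a)" "\<lambda>b. h b - of_bool (b = a)" "headQ a" s'])
        show "l1 (\<lambda>b. g b - (f b + of_bool (b = a))) < l1 (\<lambda>b. g b - f b)"
          by (rule l1_less[of _ a]) (use a in auto)
        show "0 \<le> h b - of_bool (b = a)" for b
          using that(1) that(2)[of b] by (cases "b = a") auto
      qed (use a f0 ef that in \<open>auto simp: excess_add excess_diff excess_unit\<close>)
      show ?thesis
      proof (cases "h a > 0")
        case True
        then show ?thesis using advance h0 eh C p q pq bound by blast
      next
        case False
        \<comment> \<open>Since \<open>h a = 0\<close> and \<open>f a < g a\<close>, the bound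
          forces some member of \<open>C\<close> to use \<open>a\<close>.\<close>
        then have "(\<Sum>x\<in>#C. x a) \<noteq> 0" using bound[of a] a(2) h0[of a] by auto
        then have "\<exists>x\<in>#C. x a \<noteq> 0" by (induction C) auto
        then obtain x where x: "x \<in># C" "x a \<noteq> 0" by blast
        with C have xf: "x \<in> flows \<theta>" by auto
        then have xa: "x a > 0" and x0: "\<And>a. x a \<ge> 0" and ex: "\<And>u. excess x u = \<theta> u"
          using x(2) by (auto simp: flows_def less_le)
        obtain C' where C': "C = add_mset x C'" using x(1) by (meson multi_member_split)
        obtain P where P: "conformal P (\<lambda>a. x a - h a)"
          "\<And>u. excess P u = of_bool (u = v') - of_bool (u = s')"
          "\<And>a. tailQ a = v' \<Longrightarrow> P a \<le> 0"
          using conformal_path[of v' "\<lambda>a. x a - h a" s'] ex eh by (auto simp: excess_diff)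
        define h' y where "h' = (\<lambda>a. x a - P a)" and "y = (\<lambda>a. h a + P a)"
        note nonneg = conformal_exchange_nonneg[OF P(1) x0 h0]
        have h'a: "h' a > 0" using P(3)[OF a(1)] xa by (simp add: h'_def)
        have h'0: "\<And>b. 0 \<le> h' b" using nonneg by (simp add: h'_def)
        have eh': "excess h' u = \<theta> u - of_bool (u = v') + of_bool (u = s')" for u
          using ex[of u] P(2)[of u] by (simp add: h'_def excess_diff)
        have y: "y \<in> flows \<theta>"
          using nonneg eh P(2) by (simp add: flows_def y_def excess_add)
        obtain p' q' where p': "p' \<in> flows \<theta>" "q' \<in> flows \<theta>" "\<And>a. p' a + q' a = f a + h' a"
          using balance_pair[OF f0 h'0 ef eh'] by blast
        \<comment> \<open>\<open>p + q + x = f + h + x = f + h' + y = p' + q' + y\<close>: the only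
          move of three flows, and the source of the degree bound 3.\<close>
        have "conn \<theta> ({#p, q, x#} + C') ({#p', q', y#} + C')"
        proof (rule conn.move)
          show "(\<Sum>x\<in>#{#p, q, x#}. x b) = (\<Sum>x\<in>#{#p', q', y#}. x b)" for b
            using pq[of b] p'(3)[of b] by (simp add: h'_def y_def)
        qed (use p q xf p' y C C' in auto)
        then have m: "conn \<theta> (add_mset p (add_mset q C)) (add_mset p' (add_mset q' (add_mset y C')))"
          by (simp add: C')
        have "\<exists>D. conn \<theta> (add_mset p' (add_mset q' (add_mset y C'))) (add_mset g D)"
        proof (rule advance[of h'])
          show "g b \<le> f b + h' b + (\<Sum>x\<in>#add_mset y C'. x b)" for b
            using bound[of b] C' by (simp add: h'_def y_def)
        qed (use h'a h'0 eh' y C C' p' in auto)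
        then show ?thesis using conn.trans[OF m] by blast
      qed
    qed
  qed
qed

theorem flows_conn:
  assumes "set_mset M \<subseteq> flows \<theta>" "set_mset N \<subseteq> flows \<theta>" "size M = size N"
    and "\<And>a. (\<Sum>x\<in>#M. x a) = (\<Sum>x\<in>#N. x a)"
  shows "conn \<theta> M N"
  using assms
proof (induction N arbitrary: M)
  case empty
  then show ?case by (auto intro: conn_refl)
next
  case (add g N)
  have g: "g \<in> flows \<theta>" using add.prems by auto
  have gle: "g a \<le> (\<Sum>x\<in>#M. x a)" for a
  proof -
    have "0 \<le> (\<Sum>x\<in>#N. x a)"
      using add.prems(2) by (induction N) (auto simp: flows_def)
    then show ?thesis using add.prems(4)[of a] by simp
  qed
  obtain p M' where M': "M = add_mset p M'"
    using add.prems(3) by (metis size_eq_Suc_imp_eq_union size_add_mset)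
  have "\<exists>D. conn \<theta> M (add_mset g D)"
  proof (cases M')
    \<comment> \<open>Without a second flow there is no partner, but then the sums force
      \<open>p = g\<close>.\<close>
    case empty
    then have "N = {#}" using add.prems(3) M' by simp
    then have "p = g" using add.prems(4) M' empty by auto
    then show ?thesis using M' add.prems(1) conn_refl by blast
  next
    case (add q C)
    \<comment> \<open>Equal defect vertices cancel, so the extraction starts from two genuine flows;
      the vertex itself is arbitrary.\<close>
    show ?thesis unfolding M' add
      by (rule conn_extract_defect[OF g, of p q undefined undefined])
        (use \<open>set_mset M \<subseteq> _\<close> gle M' add in \<open>auto simp: flows_def add.assoc\<close>)
  qed
  then obtain D where D: "conn \<theta> M (add_mset g D)" by blast
  note inv = conn_invariant[OF D]
  have "conn \<theta> D N"
  proof (rule add.IH)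
    show "(\<Sum>x\<in>#D. x a) = (\<Sum>x\<in>#N. x a)" for a
      using inv add.prems(4)[of a] by auto
  qed (use inv add.prems in auto)
  then show ?case by (intro conn.trans[OF D] conn_add g)
qed

text \<open>Acyclicity gives a potential increasing along arrows, so that every flow has the same
  weighted total \<open>\<Sum>v. r v * \<theta> v\<close>. If it is nonzero, the sum of a multiset of flows determines
  its size; if it vanishes, the zero flow is the only flow.\<close>

lemma increasing_potential:
  assumes "no_oriented_cycles tailQ headQ"
  shows "\<exists>r :: 'v \<Rightarrow> int. \<forall>a. r (tailQ a) < r (headQ a)"
proof (intro exI allI)
  define E where "E = {(tailQ a, headQ a) | a. True}"
  have ac: "acyclic E" using assms by (simp add: no_oriented_cycles_def E_def)
  fix a
  have e: "(tailQ a, headQ a) \<in> E" by (auto simp: E_def)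
  \<comment> \<open>The potential counts the predecessors of a vertex. Along an arrow this set gains
    at least the tail, which by acyclicity does not precede itself.\<close>
  have "{u. (u, tailQ a) \<in> E\<^sup>+} \<subset> {u. (u, headQ a) \<in> E\<^sup>+}"
  proof
    show "{u. (u, tailQ a) \<in> E\<^sup>+} \<subseteq> {u. (u, headQ a) \<in> E\<^sup>+}"
      using e by (auto intro: trancl_into_trancl)
    have "tailQ a \<in> {u. (u, headQ a) \<in> E\<^sup>+}" using e by auto
    moreover have "tailQ a \<notin> {u. (u, tailQ a) \<in> E\<^sup>+}" using ac by (auto simp: acyclic_def)
    ultimately show "{u. (u, tailQ a) \<in> E\<^sup>+} \<noteq> {u. (u, headQ a) \<in> E\<^sup>+}" by blast
  qed
  then show "int (card {u. (u, tailQ a) \<in> E\<^sup>+}) < int (card {u. (u, headQ a) \<in> E\<^sup>+})"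
    by (simp add: psubset_card_mono)
qed

text \<open>Summation by parts, grouping the arrows once by head and once by tail.\<close>

lemma sum_potential_excess:
  "(\<Sum>a\<in>UNIV. x a * (r (headQ a) - r (tailQ a))) = (\<Sum>v\<in>UNIV. r v * excess x v)"
proof -
  have *: "(\<Sum>a\<in>UNIV. x a * r (k a)) = (\<Sum>v\<in>UNIV. r v * (\<Sum>a | k a = v. x a))"
    for k :: "'a \<Rightarrow> 'v"
  proof -
    have "(\<Sum>a\<in>UNIV. x a * r (k a)) = (\<Sum>v\<in>UNIV. \<Sum>a | k a = v. x a * r (k a))"
      using sum.group[of UNIV UNIV k "\<lambda>a. x a * r (k a)"] by simp
    also have "\<dots> = (\<Sum>v\<in>UNIV. r v * (\<Sum>a | k a = v. x a))"
      by (simp add: sum_distrib_left mult.commute)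
    finally show ?thesis .
  qed
  show ?thesis
    by (simp add: excess_def right_diff_distrib sum_subtractf *)
qed

lemma sum_mset_potential:
  assumes "set_mset M \<subseteq> flows \<theta>"
  shows "(\<Sum>a\<in>UNIV. (\<Sum>x\<in>#M. x a) * (r (headQ a) - r (tailQ a)))
    = int (size M) * (\<Sum>v\<in>UNIV. r v * \<theta> v)"
  using assms
proof (induction M)
  case (add x M)
  then have "(\<Sum>a\<in>UNIV. x a * (r (headQ a) - r (tailQ a))) = (\<Sum>v\<in>UNIV. r v * \<theta> v)"
    by (simp add: sum_potential_excess flows_def)
  then show ?case using add by (simp add: distrib_right sum.distrib)
qed simp

lemma size_eq_or_flows_trivial:
  assumes "no_oriented_cycles tailQ headQ"
  shows "(\<forall>M N. set_mset M \<subseteq> flows \<theta> \<longrightarrow> set_mset N \<subseteq> flows \<theta> \<longrightarrow>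
      (\<forall>a. (\<Sum>x\<in>#M. x a) = (\<Sum>x\<in>#N. x a)) \<longrightarrow> size M = size N)
    \<or> flows \<theta> \<subseteq> {\<lambda>a. 0}"
proof -
  obtain r :: "'v \<Rightarrow> int" where r: "\<And>a. r (tailQ a) < r (headQ a)"
    using increasing_potential[OF assms] by auto
  show ?thesis
  proof (cases "(\<Sum>v\<in>UNIV. r v * \<theta> v) = 0")
    case True
    have "x a = 0" if x: "x \<in> flows \<theta>" for x a
    proof -
      have "(\<Sum>a\<in>UNIV. x a * (r (headQ a) - r (tailQ a))) = 0"
        using True x by (simp add: sum_potential_excess flows_def)
      moreover have "x a * (r (headQ a) - r (tailQ a)) \<ge> 0" for a
        using x r[of a] by (simp add: flows_def)
      ultimately have "x a * (r (headQ a) - r (tailQ a)) = 0"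
        by (simp add: sum_nonneg_eq_0_iff)
      then show ?thesis using r[of a] by simp
    qed
    then have "flows \<theta> \<subseteq> {\<lambda>a. 0}" by auto
    then show ?thesis ..
  next
    case False
    have sz: "size M = size N"
      if "set_mset M \<subseteq> flows \<theta>" "set_mset N \<subseteq> flows \<theta>"
        "\<And>a. (\<Sum>x\<in>#M. x a) = (\<Sum>x\<in>#N. x a)" for M N
    proof -
      have "int (size M) * (\<Sum>v\<in>UNIV. r v * \<theta> v) = int (size N) * (\<Sum>v\<in>UNIV. r v * \<theta> v)"
        using sum_mset_potential[OF that(1), of r] sum_mset_potential[OF that(2), of r] that(3)
        by (simp, argo)
      then show ?thesis using False by simp
    qed
    show ?thesis by (intro disjI1 allI impI) (rule sz, auto)
  qed
qed

lemma quiver_lattice_points_iff: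
  "m \<in> quiver_lattice_points tailQ headQ \<theta> \<longleftrightarrow> (\<lambda>a. int (m a)) \<in> flows \<theta>"
  by (auto simp: quiver_lattice_points_def flows_def excess_def)

end

section \<open>The polynomial ring and its toric map\<close>

lemma sum_single_keys:
  fixes p :: "'k \<Rightarrow>\<^sub>0 'b::comm_monoid_add"
  shows "(\<Sum>k\<in>Poly_Mapping.keys p. Poly_Mapping.single k (Poly_Mapping.lookup p k)) = p"
  by (rule poly_mapping_eqI)
    (auto simp: lookup_sum lookup_single when_def in_keys_iff)

text \<open>The exponent of the image of the monomial \<open>mu\<close> under the toric map.\<close>

definition expo :: "(('a::finite \<Rightarrow> nat) \<Rightarrow>\<^sub>0 nat) \<Rightarrow> ('a \<Rightarrow>\<^sub>0 nat)" where
  "expo mu = (\<Sum>m\<in>Poly_Mapping.keys mu. Abs_poly_mapping (\<lambda>a. Poly_Mapping.lookup mu m * m a))"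

lemma lookup_expo:
  assumes "finite S" "Poly_Mapping.keys mu \<subseteq> S"
  shows "Poly_Mapping.lookup (expo mu) a = (\<Sum>m\<in>S. Poly_Mapping.lookup mu m * m a)"
proof -
  have "Poly_Mapping.lookup (expo mu) a = (\<Sum>m\<in>Poly_Mapping.keys mu. Poly_Mapping.lookup mu m * m a)"
    by (simp add: expo_def lookup_sum)
  also have "\<dots> = (\<Sum>m\<in>S. Poly_Mapping.lookup mu m * m a)"
    using assms by (intro sum.mono_neutral_left) (auto simp: in_keys_iff)
  finally show ?thesis .
qed

lemma expo_add: "expo (mu + nu) = expo mu + expo nu"
proof (rule poly_mapping_eqI)
  fix a
  let ?S = "Poly_Mapping.keys mu \<union> Poly_Mapping.keys nu"
  have "Poly_Mapping.lookup (expo (mu + nu)) a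
      = (\<Sum>m\<in>?S. Poly_Mapping.lookup (mu + nu) m * m a)"
    by (rule lookup_expo) (simp_all add: Poly_Mapping.keys_add)
  then show "Poly_Mapping.lookup (expo (mu + nu)) a = Poly_Mapping.lookup (expo mu + expo nu) a"
    by (simp add: lookup_expo[of ?S] lookup_add distrib_right sum.distrib)
qed

lemma xmon_power: "xmon m ^ k = Poly_Mapping.single (Abs_poly_mapping (\<lambda>a. k * m a)) 1"
proof (induction k)
  case (Suc k)
  have "Abs_poly_mapping m + Abs_poly_mapping (\<lambda>a. k * m a) = Abs_poly_mapping (\<lambda>a. Suc k * m a)"
    by (rule poly_mapping_eqI) (simp add: lookup_add)
  then show ?case using Suc by (simp add: xmon_def mult_single)
qed simp

lemma prod_xmon_power:
  assumes "finite K"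
  shows "(\<Prod>m\<in>K. xmon m ^ k m)
    = Poly_Mapping.single (\<Sum>m\<in>K. Abs_poly_mapping (\<lambda>a. k m * m a)) 1"
  using assms by induction (simp_all add: xmon_power mult_single)

lemma quiver_phi_superset:
  assumes "finite S" "Poly_Mapping.keys p \<subseteq> S"
  shows "quiver_phi p = (\<Sum>mu\<in>S. Poly_Mapping.single (expo mu) (Poly_Mapping.lookup p mu))"
proof -
  have "quiver_phi p
      = (\<Sum>mu\<in>Poly_Mapping.keys p. Poly_Mapping.single (expo mu) (Poly_Mapping.lookup p mu))"
    by (simp add: quiver_phi_def prod_xmon_power mult_single flip: expo_def)
  also have "\<dots> = (\<Sum>mu\<in>S. Poly_Mapping.single (expo mu) (Poly_Mapping.lookup p mu))"
    using assms by (intro sum.mono_neutral_left) (auto simp: in_keys_iff)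
  finally show ?thesis .
qed

lemma quiver_phi_add: "quiver_phi (p + q) = quiver_phi p + quiver_phi q"
proof -
  let ?S = "Poly_Mapping.keys p \<union> Poly_Mapping.keys q"
  have "quiver_phi (p + q)
      = (\<Sum>mu\<in>?S. Poly_Mapping.single (expo mu) (Poly_Mapping.lookup (p + q) mu))"
    by (rule quiver_phi_superset) (simp_all add: Poly_Mapping.keys_add)
  then show ?thesis
    by (simp add: quiver_phi_superset[of ?S] lookup_add single_add sum.distrib)
qed

lemma quiver_phi_single: "quiver_phi (Poly_Mapping.single mu c) = Poly_Mapping.single (expo mu) c"
  using quiver_phi_superset[of "{mu}" "Poly_Mapping.single mu c"] by simp

lemma quiver_phi_sum: "quiver_phi (sum f S) = (\<Sum>i\<in>S. quiver_phi (f i))"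
proof (induction S rule: infinite_finite_induct)
  case empty
  then show ?case using quiver_phi_superset[of "{}" 0] by simp
qed (simp_all add: quiver_phi_add quiver_phi_superset[of "{}" 0])

text \<open>Both factors are expanded into monomials, where multiplicativity is additivity of
  \<open>expo\<close>.\<close>

lemma quiver_phi_mult: "quiver_phi (p * q) = quiver_phi p * quiver_phi q"
proof -
  let ?s = "\<lambda>p mu. Poly_Mapping.single mu (Poly_Mapping.lookup p mu)"
  have "p * q = (\<Sum>mu\<in>Poly_Mapping.keys p. ?s p mu) * (\<Sum>nu\<in>Poly_Mapping.keys q. ?s q nu)"
    by (simp add: sum_single_keys)
  also have "quiver_phi \<dots> = (\<Sum>mu\<in>Poly_Mapping.keys p. quiver_phi (?s p mu))
      * (\<Sum>nu\<in>Poly_Mapping.keys q. quiver_phi (?s q nu))"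
    by (simp add: sum_product quiver_phi_sum mult_single quiver_phi_single expo_add)
  also have "\<dots> = quiver_phi p * quiver_phi q"
    by (simp add: sum_single_keys flip: quiver_phi_sum)
  finally show ?thesis .
qed

lemma quiver_phi_diff: "quiver_phi (p - q) = quiver_phi p - quiver_phi q"
  using quiver_phi_add[of "p - q" q] by simp

section \<open>Polynomial subrings and generated ideals\<close>

lemma cpoly_ring_iff:
  "p \<in> cpoly_ring X \<longleftrightarrow> (\<forall>mu\<in>Poly_Mapping.keys p. Poly_Mapping.keys mu \<subseteq> X)"
  by (auto simp: cpoly_ring_def cpoly_vars_def)

lemma cpoly_ring_sum:
  assumes "\<And>i. i \<in> S \<Longrightarrow> f i \<in> cpoly_ring X"
  shows "sum f S \<in> cpoly_ring X"
  unfolding cpoly_ring_iff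
proof
  fix mu assume "mu \<in> Poly_Mapping.keys (sum f S)"
  then obtain i where "i \<in> S" "mu \<in> Poly_Mapping.keys (f i)"
    using keys_sum[of f S] by blast
  then show "Poly_Mapping.keys mu \<subseteq> X"
    using assms by (simp add: cpoly_ring_iff)
qed

lemma cpoly_ring_mult:
  assumes "p \<in> cpoly_ring X" "q \<in> cpoly_ring X"
  shows "p * q \<in> cpoly_ring X"
  unfolding cpoly_ring_iff
proof
  fix mu assume "mu \<in> Poly_Mapping.keys (p * q)"
  then obtain a b where ab: "mu = a + b" "a \<in> Poly_Mapping.keys p" "b \<in> Poly_Mapping.keys q"
    using keys_mult[of p q] by blast
  then have "Poly_Mapping.keys a \<subseteq> X" "Poly_Mapping.keys b \<subseteq> X"
    using assms by (simp_all add: cpoly_ring_iff)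
  then show "Poly_Mapping.keys mu \<subseteq> X"
    using Poly_Mapping.keys_add[of a b] ab(1) by blast
qed

lemma ideal_gen_in_mult: "r \<in> R \<Longrightarrow> g \<in> G \<Longrightarrow> r * g \<in> ideal_gen_in R G"
  unfolding ideal_gen_in_def
  by (rule CollectI, intro exI[of _ "{0::nat}"] exI[of _ "\<lambda>_. r"] exI[of _ "\<lambda>_. g"]) simp

lemma ideal_gen_in_zero: "0 \<in> ideal_gen_in R G"
  unfolding ideal_gen_in_def by (rule CollectI, intro exI[of _ "{}"]) simp

lemma ideal_gen_in_add:
  assumes "p \<in> ideal_gen_in R G" "q \<in> ideal_gen_in R G"
  shows "p + q \<in> ideal_gen_in R G"
proof -
  obtain I r g where I: "finite (I::nat set)" "\<forall>i\<in>I. r i \<in> R \<and> g i \<in> G" "p = (\<Sum>i\<in>I. r i * g i)"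
    using assms(1) unfolding ideal_gen_in_def by blast
  obtain J r' g' where J: "finite (J::nat set)" "\<forall>i\<in>J. r' i \<in> R \<and> g' i \<in> G"
    "q = (\<Sum>i\<in>J. r' i * g' i)"
    using assms(2) unfolding ideal_gen_in_def by blast
  \<comment> \<open>Combinations are indexed by finite sets of naturals, so the two families are
    made disjoint by placing one on even and the other on odd indices.\<close>
  let ?K = "(\<lambda>i. 2 * i) ` I \<union> (\<lambda>i. Suc (2 * i)) ` J"
  let ?r = "\<lambda>k. if even k then r (k div 2) else r' (k div 2)"
  let ?g = "\<lambda>k. if even k then g (k div 2) else g' (k div 2)"
  have "(\<Sum>k\<in>?K. ?r k * ?g k)
      = (\<Sum>k\<in>(\<lambda>i. 2 * i) ` I. ?r k * ?g k) + (\<Sum>k\<in>(\<lambda>i. Suc (2 * i)) ` J. ?r k * ?g k)"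
    using I(1) J(1) by (intro sum.union_disjoint) (auto, presburger)
  also have "\<dots> = p + q"
    by (simp add: sum.reindex inj_on_def I(3) J(3))
  finally have "p + q = (\<Sum>k\<in>?K. ?r k * ?g k)" ..
  moreover have "finite ?K" "\<forall>k\<in>?K. ?r k \<in> R \<and> ?g k \<in> G"
    using I(1,2) J(1,2) by auto
  ultimately show ?thesis unfolding ideal_gen_in_def
    by (intro CollectI exI[of _ ?K] exI[of _ ?r] exI[of _ ?g] conjI)
qed

lemma ideal_gen_in_sum:
  assumes "\<And>i. i \<in> S \<Longrightarrow> f i \<in> ideal_gen_in R G"
  shows "sum f S \<in> ideal_gen_in R G"
  using assms
  by (induction S rule: infinite_finite_induct) (auto intro: ideal_gen_in_add ideal_gen_in_zero)

section \<open>Monomials as multisets of variables\<close>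

definition mon :: "'x multiset \<Rightarrow> 'x \<Rightarrow>\<^sub>0 nat" where
  "mon M = (\<Sum>x\<in>#M. Poly_Mapping.single x 1)"

lemma mon_union: "mon (A + B) = mon A + mon B"
  by (simp add: mon_def)

lemma lookup_mon: "Poly_Mapping.lookup (mon M) = count M"
proof (induction M)
  case (add x M)
  then show ?case
    by (auto simp: mon_def lookup_add lookup_single when_def)
qed (auto simp: mon_def)

lemma keys_mon: "Poly_Mapping.keys (mon M) = set_mset M"
  by (auto simp: in_keys_iff lookup_mon)

lemma mon_surj: obtains M where "mu = mon M"
proof
  have "finite {x. Poly_Mapping.lookup mu x > 0}"
    by (simp add: Poly_Mapping.keys.rep_eq flip: neq0_conv)
  then show "mu = mon (Abs_multiset (Poly_Mapping.lookup mu))"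
    by (intro poly_mapping_eqI) (simp add: lookup_mon)
qed

lemma lookup_expo_mon: "Poly_Mapping.lookup (expo (mon M)) a = (\<Sum>x\<in>#M. x a)"
proof (induction M)
  case empty
  then show ?case by (simp add: mon_def lookup_expo[of "{}"])
next
  case (add x M)
  have "Poly_Mapping.lookup (expo (Poly_Mapping.single x 1)) a = x a"
    by (simp add: lookup_expo[of "{x}"])
  then show ?case
    using add mon_union[of "{#x#}" M] by (simp add: expo_add lookup_add) (simp add: mon_def)
qed

lemma single_mon_in_cpoly_ring:
  "set_mset M \<subseteq> X \<Longrightarrow> Poly_Mapping.single (mon M) c \<in> cpoly_ring X"
  by (simp add: cpoly_ring_iff keys_mon)

lemma mon_binomial_in_kernel:
  assumes "set_mset A \<subseteq> X" "set_mset B \<subseteq> X" "size A \<le> 3" "size B \<le> 3"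
    and "\<And>a. (\<Sum>x\<in>#A. x a) = (\<Sum>x\<in>#B. x a)"
  defines "p \<equiv> Poly_Mapping.single (mon A) 1 - Poly_Mapping.single (mon B) 1"
  shows "p \<in> cpoly_ring X" "quiver_phi p = 0" "cpoly_degree p \<le> 3"
proof -
  have k: "Poly_Mapping.keys p \<subseteq> {mon A, mon B}"
    using keys_diff[of "Poly_Mapping.single (mon A) (1::complex)" "Poly_Mapping.single (mon B) 1"]
    by (auto simp: p_def)
  show "p \<in> cpoly_ring X"
    unfolding cpoly_ring_iff
  proof
    fix mu assume "mu \<in> Poly_Mapping.keys p"
    then have "mu = mon A \<or> mu = mon B" using k by blast
    then show "Poly_Mapping.keys mu \<subseteq> X" using assms(1,2) by (auto simp: keys_mon)
  qed
  have "expo (mon A) = expo (mon B)"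
    by (rule poly_mapping_eqI) (simp add: lookup_expo_mon assms(5))
  then show "quiver_phi p = 0"
    by (simp add: p_def quiver_phi_diff quiver_phi_single)
  have "(\<Sum>x\<in>Poly_Mapping.keys mu. Poly_Mapping.lookup mu x) \<le> 3" if "mu \<in> Poly_Mapping.keys p" for mu
  proof -
    have "mu = mon A \<or> mu = mon B" using that k by blast
    then show ?thesis
      using assms(3,4) by (auto simp: keys_mon lookup_mon simp flip: size_multiset_overloaded_eq)
  qed
  then show "cpoly_degree p \<le> 3" by (simp add: cpoly_degree_def)
qed

section \<open>Congruence of monomials modulo low-degree relations\<close>

definition low_degree_kernel :: "('a::finite \<Rightarrow> nat) set \<Rightarrow> ('a \<Rightarrow> nat) cpoly set" where
  "low_degree_kernel X = {p \<in> cpoly_ring X. quiver_phi p = 0 \<and> cpoly_degree p \<le> 3}"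

abbreviation low_degree_ideal :: "('a::finite \<Rightarrow> nat) set \<Rightarrow> ('a \<Rightarrow> nat) cpoly set" where
  "low_degree_ideal X \<equiv> ideal_gen_in (cpoly_ring X) (low_degree_kernel X)"

text \<open>Quantifying over \<open>c\<close> lets the congruence apply directly to the terms of a
  polynomial, and negating \<open>c\<close> gives symmetry.\<close>

definition mon_cong :: "('a::finite \<Rightarrow> nat) set \<Rightarrow> ('a \<Rightarrow> nat) multiset \<Rightarrow> ('a \<Rightarrow> nat) multiset \<Rightarrow> bool"
  where "mon_cong X M N \<longleftrightarrow>
    (\<forall>c. Poly_Mapping.single (mon M) c - Poly_Mapping.single (mon N) c \<in> low_degree_ideal X)"

lemma mon_cong_sym:
  assumes "mon_cong X M N"
  shows "mon_cong X N M"
  unfolding mon_cong_def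
proof
  fix c
  have "Poly_Mapping.single (mon M) (-c) - Poly_Mapping.single (mon N) (-c) \<in> low_degree_ideal X"
    using assms by (simp only: mon_cong_def)
  then show "Poly_Mapping.single (mon N) c - Poly_Mapping.single (mon M) c \<in> low_degree_ideal X"
    by (simp add: single_uminus)
qed

lemma mon_cong_trans:
  assumes "mon_cong X L M" "mon_cong X M N"
  shows "mon_cong X L N"
  unfolding mon_cong_def
proof
  fix c
  have "(Poly_Mapping.single (mon L) c - Poly_Mapping.single (mon M) c)
      + (Poly_Mapping.single (mon M) c - Poly_Mapping.single (mon N) c) \<in> low_degree_ideal X"
    using assms by (intro ideal_gen_in_add) (simp_all add: mon_cong_def)
  then show "Poly_Mapping.single (mon L) c - Poly_Mapping.single (mon N) c \<in> low_degree_ideal X"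
    by simp
qed

text \<open>The low-degree binomial of \<open>A\<close> and \<open>B\<close> is multiplied by the
  monomial of \<open>C\<close>. The sizes of \<open>A\<close> and \<open>B\<close> may differ, as
  happens when a variable is replaced by 1.\<close>

lemma mon_cong_move:
  assumes "set_mset A \<subseteq> X" "set_mset B \<subseteq> X" "set_mset C \<subseteq> X" "size A \<le> 3" "size B \<le> 3"
    and "\<And>a. (\<Sum>x\<in>#A. x a) = (\<Sum>x\<in>#B. x a)"
  shows "mon_cong X (A + C) (B + C)"
  unfolding mon_cong_def
proof
  fix c
  have "Poly_Mapping.single (mon C) c * (Poly_Mapping.single (mon A) 1 - Poly_Mapping.single (mon B) 1)
      \<in> low_degree_ideal X"
    using assms mon_binomial_in_kernel[OF assms(1,2,4,5,6)]
    by (intro ideal_gen_in_mult single_mon_in_cpoly_ring) (auto simp: low_degree_kernel_def)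
  then show "Poly_Mapping.single (mon (A + C)) c - Poly_Mapping.single (mon (B + C)) c
      \<in> low_degree_ideal X"
    by (simp add: right_diff_distrib mult_single mon_union add.commute)
qed

section \<open>From connected flows to congruent monomials\<close>

context quiver
begin

text \<open>Flows are nonnegative, so truncation by \<open>nat\<close> preserves sums and each move
  of flows becomes a move of monomials.\<close>

lemma conn_imp_mon_cong:
  assumes "conn \<theta> M N"
  defines "nat_fun \<equiv> \<lambda>(x::'a \<Rightarrow> int) a. nat (x a)"
  shows "mon_cong (quiver_lattice_points tailQ headQ \<theta>) (image_mset nat_fun M) (image_mset nat_fun N)"
  using assms(1)
proof induction
  case (move A B C)
  have latt: "nat_fun x \<in> quiver_lattice_points tailQ headQ \<theta>" if "x \<in> flows \<theta>" for x
    using that by (simp add: quiver_lattice_points_iff nat_fun_def flows_def)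
  have sum: "int (\<Sum>x\<in>#image_mset nat_fun D. x a) = (\<Sum>x\<in>#D. x a)" if "set_mset D \<subseteq> flows \<theta>" for D a
    using that by (induction D) (auto simp: nat_fun_def flows_def)
  have "(\<Sum>x\<in>#image_mset nat_fun A. x a) = (\<Sum>x\<in>#image_mset nat_fun B. x a)" for a
  proof -
    have "set_mset A \<subseteq> flows \<theta>" "set_mset B \<subseteq> flows \<theta>" using move by auto
    from sum[OF this(1), of a] sum[OF this(2), of a] move(4)[of a] show ?thesis by linarith
  qed
  then show ?case
    using move latt unfolding image_mset_union by (intro mon_cong_move) auto
next
  case (trans A B C)
  from mon_cong_trans[OF trans.IH] show ?case .
qed

lemma mon_cong_lattice_points:
  fixes \<theta> :: "'v \<Rightarrow> int"
  assumes "no_oriented_cycles tailQ headQ"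
  defines "X \<equiv> quiver_lattice_points tailQ headQ \<theta>"
  assumes M: "set_mset M \<subseteq> X" and N: "set_mset N \<subseteq> X"
    and eq: "\<And>a. (\<Sum>x\<in>#M. x a) = (\<Sum>x\<in>#N. x a)"
  shows "mon_cong X M N"
proof -
  define int_fun where "int_fun = (\<lambda>(x::'a \<Rightarrow> nat) a. int (x a))"
  have fl: "set_mset (image_mset int_fun D) \<subseteq> flows \<theta>" if "set_mset D \<subseteq> X" for D
    using that by (auto simp: X_def quiver_lattice_points_iff int_fun_def)
  have sum: "(\<Sum>x\<in>#image_mset int_fun D. x a) = int (\<Sum>x\<in>#D. x a)" for D a
    by (induction D) (auto simp: int_fun_def)
  have eq': "(\<Sum>x\<in>#image_mset int_fun M. x a) = (\<Sum>x\<in>#image_mset int_fun N. x a)" for a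
    unfolding sum eq ..
  consider "size (image_mset int_fun M) = size (image_mset int_fun N)" | "flows \<theta> \<subseteq> {\<lambda>a. 0}"
    using size_eq_or_flows_trivial[OF assms(1), of \<theta>] fl[OF M] fl[OF N] eq' by blast
  then show ?thesis
  proof cases
    case 1
    have "conn \<theta> (image_mset int_fun M) (image_mset int_fun N)"
      by (rule flows_conn[OF fl[OF M] fl[OF N] 1 eq'])
    from conn_imp_mon_cong[OF this] show ?thesis
      by (simp add: X_def int_fun_def image_mset.compositionality o_def)
  next
    case 2
    \<comment> \<open>Only the zero flow can occur; its variable maps to 1, so a binomial of degree
      one removes the factors one at a time.\<close>
    have "mon_cong X D {#}" if "set_mset D \<subseteq> X" for D
      using that
    proof (induction D)
      case empty
      then show ?case by (simp add: mon_cong_def ideal_gen_in_zero)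
    next
      case (add x D)
      have "int_fun x \<in> flows \<theta>" using fl[OF add.prems] by simp
      then have "x a = 0" for a using 2 by (fastforce simp: int_fun_def dest: fun_cong)
      then have "mon_cong X ({#x#} + D) ({#} + D)"
        using add.prems by (intro mon_cong_move) auto
      from mon_cong_trans[OF this] show ?case using add by simp
    qed
    from mon_cong_trans[OF this[OF M] mon_cong_sym[OF this[OF N]]] show ?thesis .
  qed
qed

end

section \<open>Kernel elements as sums of binomials\<close>

lemma single_sum: "Poly_Mapping.single k (sum f S) = (\<Sum>i\<in>S. Poly_Mapping.single k (f i))"
  by (induction S rule: infinite_finite_induct) (simp_all add: single_add)

text \<open>The coefficients of \<open>p\<close> over each fiber of \<open>expo\<close> sum to a
  coefficient of \<open>quiver_phi p\<close>, hence to zero. So the subtracted terms cancel,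
  whatever \<open>rep\<close> is.\<close>

lemma kernel_eq_sum_binomials:
  assumes "quiver_phi p = 0"
  shows "p = (\<Sum>mu\<in>Poly_Mapping.keys p. Poly_Mapping.single mu (Poly_Mapping.lookup p mu)
    - Poly_Mapping.single (rep (expo mu)) (Poly_Mapping.lookup p mu))"
proof -
  let ?K = "Poly_Mapping.keys p" and ?c = "Poly_Mapping.lookup p"
  have fiber: "(\<Sum>mu | mu \<in> ?K \<and> expo mu = e. ?c mu) = 0" for e
  proof -
    have "(\<Sum>mu | mu \<in> ?K \<and> expo mu = e. ?c mu) = (\<Sum>mu\<in>?K. if expo mu = e then ?c mu else 0)"
      by (simp add: sum.inter_filter)
    also have "\<dots> = Poly_Mapping.lookup (quiver_phi p) e"
      by (simp add: quiver_phi_superset[of ?K] lookup_sum lookup_single when_def)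
    finally show ?thesis using assms by simp
  qed
  have "(\<Sum>mu\<in>?K. Poly_Mapping.single (rep (expo mu)) (?c mu))
      = (\<Sum>e\<in>expo ` ?K. \<Sum>mu | mu \<in> ?K \<and> expo mu = e. Poly_Mapping.single (rep (expo mu)) (?c mu))"
    by (rule sum.group[symmetric]) auto
  also have "\<dots> = (\<Sum>e\<in>expo ` ?K. Poly_Mapping.single (rep e) (\<Sum>mu | mu \<in> ?K \<and> expo mu = e. ?c mu))"
    by (simp add: single_sum)
  also have "\<dots> = 0" by (simp add: fiber)
  finally show ?thesis by (simp add: sum_subtractf sum_single_keys)
qed

theorem theorem9p3:
  fixes tailQ headQ :: "'a::finite \<Rightarrow> 'v::finite" and \<theta> :: "'v \<Rightarrow> int"
  assumes "no_oriented_cycles tailQ headQ"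
  shows "\<exists>G. G \<subseteq> {p \<in> cpoly_ring (quiver_lattice_points tailQ headQ \<theta>). quiver_phi p = 0}
            \<and> (\<forall>g\<in>G. cpoly_degree g \<le> 3)
            \<and> ideal_gen_in (cpoly_ring (quiver_lattice_points tailQ headQ \<theta>)) G
               = {p \<in> cpoly_ring (quiver_lattice_points tailQ headQ \<theta>). quiver_phi p = 0}"
proof (intro exI conjI)
  let ?X = "quiver_lattice_points tailQ headQ \<theta>"
  let ?ker = "{p \<in> cpoly_ring ?X. quiver_phi p = 0}"
  \<comment> \<open>All kernel elements of degree at most 3 serve as generators.\<close>
  show "low_degree_kernel ?X \<subseteq> ?ker" "\<forall>g\<in>low_degree_kernel ?X. cpoly_degree g \<le> 3"
    by (auto simp: low_degree_kernel_def)
  show "low_degree_ideal ?X = ?ker"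
  proof
    show "low_degree_ideal ?X \<subseteq> ?ker"
      by (auto simp: ideal_gen_in_def low_degree_kernel_def quiver_phi_sum quiver_phi_mult
          intro!: cpoly_ring_sum cpoly_ring_mult)
    show "?ker \<subseteq> low_degree_ideal ?X"
    proof
      fix p assume p: "p \<in> ?ker"
      \<comment> \<open>The representative is chosen among the monomials of \<open>p\<close> itself,
        so that its variables are lattice points too.\<close>
      define rep where "rep e = (SOME nu. nu \<in> Poly_Mapping.keys p \<and> expo nu = e)" for e
      have "Poly_Mapping.single mu c - Poly_Mapping.single (rep (expo mu)) c \<in> low_degree_ideal ?X"
        if mu: "mu \<in> Poly_Mapping.keys p" for mu c
      proof -
        have nu: "rep (expo mu) \<in> Poly_Mapping.keys p \<and> expo (rep (expo mu)) = expo mu"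
          unfolding rep_def by (rule someI[of _ mu]) (use mu in simp)
        obtain M where M: "mu = mon M" by (rule mon_surj)
        obtain N where N: "rep (expo mu) = mon N" by (rule mon_surj)
        have vars: "Poly_Mapping.keys k \<subseteq> ?X" if "k \<in> Poly_Mapping.keys p" for k
          using p that by (simp add: cpoly_ring_iff)
        have "mon_cong ?X M N"
        proof (rule quiver.mon_cong_lattice_points[OF assms])
          show "set_mset M \<subseteq> ?X" using vars[OF mu] M by (simp add: keys_mon)
          show "set_mset N \<subseteq> ?X" using vars[of "mon N"] nu N by (simp add: keys_mon)
          show "(\<Sum>x\<in>#M. x a) = (\<Sum>x\<in>#N. x a)" for a
            using nu M N by (simp flip: lookup_expo_mon)
        qed
        then have "Poly_Mapping.single (mon M) c - Poly_Mapping.single (mon N) c \<in> low_degree_ideal ?X"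
          by (simp add: mon_cong_def)
        then show ?thesis by (simp only: M[symmetric] N[symmetric])
      qed
      then have "(\<Sum>mu\<in>Poly_Mapping.keys p. Poly_Mapping.single mu (Poly_Mapping.lookup p mu)
          - Poly_Mapping.single (rep (expo mu)) (Poly_Mapping.lookup p mu)) \<in> low_degree_ideal ?X"
        by (intro ideal_gen_in_sum)
      then show "p \<in> low_degree_ideal ?X"
        using kernel_eq_sum_binomials[of p rep] p by simp
    qed
  qed
qed

end
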